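(* Let $P,Q$ be points on the isotropic conic $q=x_0^2+x_1^2+x_2^2$ in $\mathbb{P}^2$ and let $l$ be the line $\langle P,Q\rangle$. Let $c_1,\dots,c_s$ be conics which are all tangent to $q$ at $P$ and $Q$. Then: (1) $E(c_1\cdot c_2\cdots c_s)$ is the scheme-theoretic union of $l$, a curve of degree $2(s-1)$ and the point $E(l)$. (2) $E(l\cdot c_1\cdot c_2\cdots c_s)$ is the scheme-theoretic union of a curve of degree $2s$ and the point $E(l)$. Such 1-dimensional components of the eigenscheme are also tangent to $q$ at $P$ and $Q$.
   Context: Conics, lines and the polynomials defining them are denoted by the same letter. For a homogeneous $f\in\mathbb{C}[x_0,x_1,x_2]$, the eigenscheme $E(f)\subseteq\mathbb{P}^2$ is the closed subscheme defined by the polynomials $x_i\partial_jf-x_j\partial_if$, $0\le i<j\le 2$, where $\partial_i=\partial/\partial x_i$. For a linear form $l=a_0x_0+a_1x_1+a_2x_2$, $E(l)$ is the single point $(a_0:a_1:a_2)$.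
   Formalization: The unions are claimed only if the residual curve misses E(l) and, in (1), does not contain l; otherwise they fail, e.g. for (q+bl²)(q−bl²). In all cases E is given by the product of the ideals. P≠Q, s≥1, no c_i equals q; the tangency in (1) is for s≥2. *)

theory Defs
  imports "HOL-Analysis.Analysis" "HOL-Library.Poly_Mapping"
begin

text \<open>The polynomial ring in three variables over the complex numbers, as finitely supported functions
  from exponent vectors to coefficients. The index type \<^typ>\<open>3\<close> has the elements 0, 1, 2, in this
  order. A point of the projective plane is represented by a nonzero vector in \<^typ>\<open>complex^3\<close>.\<close>

type_synonym cpoly3 = "(3 \<Rightarrow>\<^sub>0 nat) \<Rightarrow>\<^sub>0 complex"

definition X :: "3 \<Rightarrow> cpoly3" where
  "X i = Poly_Mapping.single (Poly_Mapping.single i 1) 1"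

definition Const :: "complex \<Rightarrow> cpoly3" where
  "Const z = Poly_Mapping.single 0 z"

definition eval_at :: "cpoly3 \<Rightarrow> complex^3 \<Rightarrow> complex" where
  "eval_at f p = (\<Sum>m\<in>Poly_Mapping.keys f.
     Poly_Mapping.lookup f m * (\<Prod>i\<in>UNIV. (p $ i) ^ Poly_Mapping.lookup m i))"

text \<open>The truncated subtraction of exponents does no harm: a monomial without \<open>X i\<close> gets the
  coefficient 0.\<close>

definition pdiff :: "3 \<Rightarrow> cpoly3 \<Rightarrow> cpoly3" where
  "pdiff i f = (\<Sum>m\<in>Poly_Mapping.keys f.
     Poly_Mapping.single (m - Poly_Mapping.single i 1)
       (of_nat (Poly_Mapping.lookup m i) * Poly_Mapping.lookup f m))"

definition homogeneous :: "cpoly3 \<Rightarrow> nat \<Rightarrow> bool" where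
  "homogeneous f d \<longleftrightarrow>
     (\<forall>m\<in>Poly_Mapping.keys f. (\<Sum>i\<in>UNIV. Poly_Mapping.lookup m i) = d)"

definition linear_form :: "complex^3 \<Rightarrow> cpoly3" where
  "linear_form a = (\<Sum>i\<in>UNIV. Const (a $ i) * X i)"

definition isotropic_conic :: cpoly3 where
  "isotropic_conic = (\<Sum>i\<in>UNIV. (X i)\<^sup>2)"


text \<open>A closed subscheme of the projective plane is represented by its saturated homogeneous ideal, so
  that two sets of forms define the same subscheme iff the ideals they generate have the same
  saturation with respect to the irrelevant ideal \<open>(X 0, X 1, X 2)\<close>.\<close>

definition ideal_gen :: "cpoly3 set \<Rightarrow> cpoly3 set" where
  "ideal_gen = module.span (*)"

definition saturation :: "cpoly3 set \<Rightarrow> cpoly3 set" where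
  "saturation I = {f. \<exists>k. \<forall>i. X i ^ k * f \<in> I}"

definition subscheme :: "cpoly3 set \<Rightarrow> cpoly3 set" where
  "subscheme B = saturation (ideal_gen B)"

definition eigenscheme :: "cpoly3 \<Rightarrow> cpoly3 set" where
  "eigenscheme f = subscheme {X i * pdiff j f - X j * pdiff i f | i j. i < j}"

definition plane_curve :: "cpoly3 \<Rightarrow> cpoly3 set" where
  "plane_curve f = subscheme {f}"

text \<open>The scheme-theoretic union is given by the intersection of the ideals. The union in which common
  components are counted with multiplicity, as in the sum of two divisors, is given by their product:
  for curves, \<open>scheme_sum (plane_curve f) (plane_curve g)\<close> is the curve defined by \<open>f * g\<close>. Both
  notions agree for subschemes with disjoint supports.\<close>

definition scheme_union :: "cpoly3 set \<Rightarrow> cpoly3 set \<Rightarrow> cpoly3 set" where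
  "scheme_union I J = I \<inter> J"

definition scheme_sum :: "cpoly3 set \<Rightarrow> cpoly3 set \<Rightarrow> cpoly3 set" where
  "scheme_sum I J = subscheme {u * v | u v. u \<in> I \<and> v \<in> J}"


text \<open>The curve \<open>f\<close> is tangent to the isotropic conic \<open>q\<close> at \<open>p\<close>: the intersection multiplicity at \<open>p\<close>
  is finite and at least 2. Finiteness means that \<open>q\<close>, which is irreducible, is not a component of
  \<open>f\<close>. As \<open>q\<close> is smooth, multiplicity at least 2 means that \<open>f\<close> passes through \<open>p\<close> and
  that its gradient there is a (possibly zero) multiple of the gradient of \<open>q\<close>. Hence the double line
  through two points of \<open>q\<close> counts as a conic tangent to \<open>q\<close> at them, and \<open>q\<close> itself does not.\<close>

definition tangent_to_q :: "cpoly3 \<Rightarrow> complex^3 \<Rightarrow> bool" where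
  "tangent_to_q f p \<longleftrightarrow>
     \<not> isotropic_conic dvd f \<and> eval_at isotropic_conic p = 0 \<and> eval_at f p = 0 \<and>
     (\<exists>t. \<forall>i. eval_at (pdiff i f) p = t * eval_at (pdiff i isotropic_conic) p)"

definition bitangent_conic :: "cpoly3 \<Rightarrow> complex^3 \<Rightarrow> complex^3 \<Rightarrow> bool" where
  "bitangent_conic c p p' \<longleftrightarrow> homogeneous c 2 \<and> tangent_to_q c p \<and> tangent_to_q c p'"

end

theory Submission
  imports Defs "HOL-Computational_Algebra.Fundamental_Theorem_Algebra"
begin

text \<open>A conic tangent to \<open>q\<close> at \<open>P\<close> and \<open>Q\<close> is \<open>\<beta> l\<^sup>2 + \<alpha> q\<close> with \<open>\<beta> \<noteq> 0\<close>, so the product \<open>F\<close> of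
  the conics is \<open>G(q, l\<^sup>2)\<close> for a binary form \<open>G(u, v)\<close> of degree \<open>s\<close> in which \<open>v\<^sup>s\<close> has a nonzero
  coefficient. The derivation \<open>x\<^sub>i \<partial>\<^sub>j - x\<^sub>j \<partial>\<^sub>i\<close> kills \<open>q\<close> and maps \<open>l\<close> to the minor \<open>x\<^sub>i a\<^sub>j - x\<^sub>j a\<^sub>i\<close>.
  Hence it maps \<open>F\<close> to \<open>2 l G\<^sub>v(q, l\<^sup>2)\<close> times the minor and \<open>l F\<close> to \<open>(G + 2 v G\<^sub>v)(q, l\<^sup>2)\<close> times the
  minor, and the minors define the point \<open>E(l)\<close>. Over the complex numbers the binary forms \<open>G\<^sub>v\<close> and
  \<open>G + 2 v G\<^sub>v\<close> split into linear factors, which are again conics tangent to \<open>q\<close> at \<open>P\<close> and \<open>Q\<close>.\<close>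

subsection \<open>Polynomials in three variables\<close>

text \<open>Keys may cancel in \<open>f + g\<close>, but since \<open>h m 0 = 0\<close> all three
  sums can be taken over the union of the key sets. Additivity of substitution and of
  \<open>pdiff\<close> rests on this.\<close>

lemma sum_keys_plus:
  fixes f g :: "'a \<Rightarrow>\<^sub>0 'b::comm_monoid_add" and h :: "'a \<Rightarrow> 'b \<Rightarrow> 'c::comm_monoid_add"
  assumes "\<And>m. h m 0 = 0" and "\<And>m x y. h m (x + y) = h m x + h m y"
  shows "(\<Sum>m\<in>Poly_Mapping.keys (f + g). h m (Poly_Mapping.lookup (f + g) m)) =
    (\<Sum>m\<in>Poly_Mapping.keys f. h m (Poly_Mapping.lookup f m)) +
    (\<Sum>m\<in>Poly_Mapping.keys g. h m (Poly_Mapping.lookup g m))"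
  using setsum_keys_plus_distrib[of h f g] assms by auto

lemma poly_mapping_sum_single:
  "(\<Sum>m\<in>Poly_Mapping.keys f. Poly_Mapping.single m (Poly_Mapping.lookup f m)) = f"
proof (rule poly_mapping_eqI)
  fix k
  have "(\<Sum>m\<in>Poly_Mapping.keys f. Poly_Mapping.lookup f m when m = k) =
      (if k \<in> Poly_Mapping.keys f then Poly_Mapping.lookup f k else 0)"
    unfolding when_def by (rule sum.delta) simp
  also have "\<dots> = Poly_Mapping.lookup f k"
    by (metis in_keys_iff)
  finally have "(\<Sum>m\<in>Poly_Mapping.keys f. Poly_Mapping.lookup f m when m = k) = Poly_Mapping.lookup f k" .
  then show "Poly_Mapping.lookup (\<Sum>m\<in>Poly_Mapping.keys f. Poly_Mapping.single m (Poly_Mapping.lookup f m)) k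
      = Poly_Mapping.lookup f k"
    by (simp add: lookup_sum lookup_single)
qed

lemma poly_mapping_single_add_induct [case_names zero single add]:
  fixes f :: "'a \<Rightarrow>\<^sub>0 'b::comm_monoid_add"
  assumes z: "P 0" and s: "\<And>m z. P (Poly_Mapping.single m z)"
    and a: "\<And>f g. P f \<Longrightarrow> P g \<Longrightarrow> P (f + g)"
  shows "P f"
proof -
  \<comment> \<open>Generalised to an arbitrary set \<open>A\<close> so that induction on
    \<open>A\<close> applies; for infinite \<open>A\<close> the sum is 0 by default.\<close>
  have "P (\<Sum>m\<in>A. Poly_Mapping.single m (Poly_Mapping.lookup f m))" for A
    by (induction A rule: infinite_finite_induct) (auto intro: z s a)
  from this[of "Poly_Mapping.keys f"] show ?thesis by (simp add: poly_mapping_sum_single)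
qed

lemma Const_0 [simp]: "Const 0 = 0" and Const_1 [simp]: "Const 1 = 1"
  and Const_add: "Const (x + y) = Const x + Const y"
  and Const_mult: "Const (x * y) = Const x * Const y"
  by (simp_all add: Const_def single_add mult_single)

lemma Const_numeral: "Const (numeral n) = numeral n"
  and Const_of_nat: "Const (of_nat k) = of_nat k"
  by (simp_all add: Const_def)

lemma Const_sum: "Const (sum f A) = (\<Sum>x\<in>A. Const (f x))"
  by (induction A rule: infinite_finite_induct) (auto simp: Const_add)

lemma Const_prod: "Const (prod f A) = (\<Prod>x\<in>A. Const (f x))"
  by (induction A rule: infinite_finite_induct) (auto simp: Const_mult)

lemma Const_inverse_mult: "z \<noteq> 0 \<Longrightarrow> Const (inverse z) * (Const z * f) = f"
  by (simp add: mult.assoc[symmetric] Const_mult[symmetric])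

definition monomial :: "(3 \<Rightarrow>\<^sub>0 nat) \<Rightarrow> cpoly3" where
  "monomial m = (\<Prod>i\<in>UNIV. X i ^ Poly_Mapping.lookup m i)"

lemma X_power: "X i ^ n = Poly_Mapping.single (Poly_Mapping.single i n) 1"
  by (induction n) (auto simp: X_def mult_single single_add[symmetric])

lemma prod_single:
  "(\<Prod>i\<in>A. Poly_Mapping.single (f i) (1::complex)) = Poly_Mapping.single (sum f A) 1"
  by (induction A rule: infinite_finite_induct) (auto simp: mult_single)

lemma sum_single_lookup:
  "(\<Sum>i\<in>UNIV. Poly_Mapping.single i (Poly_Mapping.lookup m i)) = (m :: 'a::finite \<Rightarrow>\<^sub>0 'b::comm_monoid_add)"
proof -
  have "(\<Sum>i\<in>UNIV. Poly_Mapping.single i (Poly_Mapping.lookup m i)) =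
      (\<Sum>i\<in>Poly_Mapping.keys m. Poly_Mapping.single i (Poly_Mapping.lookup m i))"
    by (rule sum.mono_neutral_right) (auto simp: in_keys_iff)
  then show ?thesis by (simp add: poly_mapping_sum_single)
qed

lemma single_eq_Const_monomial: "Poly_Mapping.single m z = Const z * monomial m"
  by (simp add: monomial_def X_power prod_single sum_single_lookup Const_def mult_single)

text \<open>Constants and variables generate the ring, so properties stable under sums and products
  need no monomial calculations.\<close>

lemma cpoly3_induct [case_names Const X add mult]:
  assumes c: "\<And>z. P (Const z)" and x: "\<And>i. P (X i)"
    and a: "\<And>f g. P f \<Longrightarrow> P g \<Longrightarrow> P (f + g)"
    and m: "\<And>f g. P f \<Longrightarrow> P g \<Longrightarrow> P (f * g)"
  shows "P f"
proof (induction f rule: poly_mapping_single_add_induct)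
  case zero
  show ?case using c[of 0] by simp
next
  case (single k z)
  have one: "P 1" using c[of 1] by simp
  have pw: "P (X i ^ n)" for i n
    by (induction n) (auto intro: m x one)
  have "P (\<Prod>i\<in>A. X i ^ Poly_Mapping.lookup k i)" for A
    by (induction A rule: infinite_finite_induct) (auto intro: m pw one)
  then show ?case unfolding single_eq_Const_monomial monomial_def by (intro m c)
qed (rule a)

section \<open>Ring homomorphisms out of the polynomial ring\<close>

definition poly_subst :: "(complex \<Rightarrow> 'b) \<Rightarrow> (3 \<Rightarrow> 'b) \<Rightarrow> cpoly3 \<Rightarrow> 'b::comm_ring_1" where
  "poly_subst h v f = (\<Sum>m\<in>Poly_Mapping.keys f.
     h (Poly_Mapping.lookup f m) * (\<Prod>i\<in>UNIV. v i ^ Poly_Mapping.lookup m i))"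

text \<open>Covers two cases at once: \<open>h\<close> the identity gives evaluation at a point,
  \<open>h = Const\<close> gives substitution of polynomials for the variables.\<close>

locale coefficient_hom =
  fixes h :: "complex \<Rightarrow> 'b::comm_ring_1"
  assumes h_zero: "h 0 = 0" and h_one: "h 1 = 1"
    and h_add: "h (x + y) = h x + h y" and h_mult: "h (x * y) = h x * h y"
begin

lemma subst_add: "poly_subst h v (f + g) = poly_subst h v f + poly_subst h v g"
  unfolding poly_subst_def by (rule sum_keys_plus) (auto simp: h_zero h_add algebra_simps)

lemma subst_single:
  "poly_subst h v (Poly_Mapping.single m z) = h z * (\<Prod>i\<in>UNIV. v i ^ Poly_Mapping.lookup m i)"
  by (cases "z = 0") (auto simp: poly_subst_def h_zero)

lemma subst_zero [simp]: "poly_subst h v 0 = 0"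
  by (simp add: poly_subst_def)

lemma subst_Const [simp]: "poly_subst h v (Const z) = h z"
  by (simp add: Const_def subst_single)

lemma subst_one [simp]: "poly_subst h v 1 = 1"
  using subst_Const[of v 1] by (simp add: h_one)

lemma subst_X [simp]: "poly_subst h v (X i) = v i"
proof -
  have "(\<Prod>j\<in>UNIV. v j ^ Poly_Mapping.lookup (Poly_Mapping.single i 1) j) = (\<Prod>j\<in>{i}. v j)"
    by (rule prod.mono_neutral_cong_right) (auto simp: lookup_single)
  then show ?thesis by (simp add: X_def subst_single h_one)
qed

lemma subst_mult: "poly_subst h v (f * g) = poly_subst h v f * poly_subst h v g"
proof (induction f rule: poly_mapping_single_add_induct)
  case (single m z)
  show ?case
  proof (induction g rule: poly_mapping_single_add_induct)
    case (single n w)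
    show ?case
      by (simp add: mult_single subst_single h_mult lookup_add power_add prod.distrib mult_ac)
  qed (simp_all add: subst_add distrib_left)
qed (simp_all add: subst_add distrib_right)

lemma subst_uminus: "poly_subst h v (- f) = - poly_subst h v f"
  using subst_add[of v f "- f"] by (simp add: add_eq_0_iff)

lemma subst_diff: "poly_subst h v (f - g) = poly_subst h v f - poly_subst h v g"
  using subst_add[of v f "- g"] by (simp add: subst_uminus)

lemma subst_power: "poly_subst h v (f ^ n) = poly_subst h v f ^ n"
  by (induction n) (auto simp: subst_mult)

lemma subst_sum: "poly_subst h v (sum f A) = (\<Sum>x\<in>A. poly_subst h v (f x))"
  by (induction A rule: infinite_finite_induct) (auto simp: subst_add)

lemma subst_prod: "poly_subst h v (prod f A) = (\<Prod>x\<in>A. poly_subst h v (f x))"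
  by (induction A rule: infinite_finite_induct) (auto simp: subst_mult)

end

interpretation evaluation: coefficient_hom "\<lambda>z. z"
  by unfold_locales auto

interpretation substitution: coefficient_hom Const
  by unfold_locales (auto simp: Const_add Const_mult)

lemma eval_at_eq_subst: "eval_at f p = poly_subst (\<lambda>z. z) (\<lambda>i. p $ i) f"
  by (simp add: eval_at_def poly_subst_def)

lemma eval_at_simps [simp]:
  "eval_at (f + g) p = eval_at f p + eval_at g p"
  "eval_at (f - g) p = eval_at f p - eval_at g p"
  "eval_at (- f) p = - eval_at f p"
  "eval_at (f * g) p = eval_at f p * eval_at g p"
  "eval_at (f ^ n) p = eval_at f p ^ n"
  "eval_at (Const z) p = z" "eval_at (X i) p = p $ i"
  "eval_at 0 p = 0" "eval_at 1 p = 1"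
  "eval_at (sum F A) p = (\<Sum>x\<in>A. eval_at (F x) p)"
  "eval_at (prod F A) p = (\<Prod>x\<in>A. eval_at (F x) p)"
  by (simp_all add: eval_at_eq_subst evaluation.subst_add evaluation.subst_diff
      evaluation.subst_uminus evaluation.subst_mult evaluation.subst_power
      evaluation.subst_sum evaluation.subst_prod)

lemma eval_at_numeral [simp]: "eval_at (numeral n) p = numeral n"
  using eval_at_simps(6)[of "numeral n"] by (simp add: Const_numeral)

section \<open>Partial derivatives\<close>

lemma pdiff_single: "pdiff i (Poly_Mapping.single m z) =
    Poly_Mapping.single (m - Poly_Mapping.single i 1) (of_nat (Poly_Mapping.lookup m i) * z)"
  by (cases "z = 0") (auto simp: pdiff_def)

lemma pdiff_zero [simp]: "pdiff i 0 = 0"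
  by (simp add: pdiff_def)

lemma pdiff_add: "pdiff i (f + g) = pdiff i f + pdiff i g"
  unfolding pdiff_def by (rule sum_keys_plus) (auto simp: single_add distrib_left)

lemma pdiff_Const [simp]: "pdiff i (Const z) = 0"
  by (simp add: Const_def pdiff_single)

lemma pdiff_one [simp]: "pdiff i 1 = 0"
  using pdiff_Const[of i 1] by simp

lemma pdiff_X: "pdiff i (X j) = (if i = j then 1 else 0)"
  by (simp add: X_def pdiff_single lookup_single)

lemma diff_single_add_single:
  fixes m :: "'a \<Rightarrow>\<^sub>0 nat"
  assumes "Poly_Mapping.lookup m i \<noteq> 0"
  shows "(m - Poly_Mapping.single i 1) + Poly_Mapping.single i 1 = m"
  using assms by (intro poly_mapping_eqI) (auto simp: lookup_add lookup_minus lookup_single when_def)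

text \<open>If \<open>X i\<close> does not occur in \<open>n\<close>, truncated subtraction may give
  different exponents on the two sides, but then both coefficients are 0. This is one half of the
  Leibniz rule on monomials and, with \<open>m\<close> a single variable, the core of Euler's
  formula.\<close>

lemma single_mult_pdiff_single:
  "Poly_Mapping.single m z * pdiff i (Poly_Mapping.single n w) =
    Poly_Mapping.single (m + n - Poly_Mapping.single i 1) (of_nat (Poly_Mapping.lookup n i) * (z * w))"
proof (cases "Poly_Mapping.lookup n i = 0")
  case False
  have "m + (n - Poly_Mapping.single i 1) = m + n - Poly_Mapping.single i 1"
    using diff_single_add_single[OF False] by (metis add.assoc add_diff_cancel_right')
  then show ?thesis by (simp add: pdiff_single mult_single mult_ac)
qed (simp add: pdiff_single)

lemma pdiff_mult: "pdiff i (f * g) = f * pdiff i g + pdiff i f * g"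
proof (induction f rule: poly_mapping_single_add_induct)
  case (single m z)
  show ?case
  proof (induction g rule: poly_mapping_single_add_induct)
    case (single n w)
    have "pdiff i (Poly_Mapping.single m z) * Poly_Mapping.single n w =
        Poly_Mapping.single (m + n - Poly_Mapping.single i 1) (of_nat (Poly_Mapping.lookup m i) * (z * w))"
      using single_mult_pdiff_single[of n w i m z] by (simp add: mult_ac add_ac)
    then show ?case
      by (simp only: single_mult_pdiff_single)
        (simp add: mult_single pdiff_single lookup_add single_add[symmetric] distrib_right add_ac)
  qed (auto simp: pdiff_add distrib_left)
qed (auto simp: pdiff_add distrib_right)

lemma pdiff_sum: "pdiff i (sum f A) = (\<Sum>x\<in>A. pdiff i (f x))"
  by (induction A rule: infinite_finite_induct) (auto simp: pdiff_add)

lemma pdiff_Const_mult: "pdiff i (Const z * f) = Const z * pdiff i f"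
  by (simp add: pdiff_mult)

lemma pdiff_commute: "pdiff i (pdiff j f) = pdiff j (pdiff i f)"
  by (induction f rule: cpoly3_induct) (auto simp: pdiff_add pdiff_mult pdiff_X add_ac)

section \<open>Homogeneous polynomials\<close>

lemma homogeneous_zero [simp]: "homogeneous 0 d"
  by (simp add: homogeneous_def)

lemma homogeneous_one [simp]: "homogeneous 1 0"
  by (simp add: homogeneous_def)

lemma homogeneous_Const: "homogeneous (Const z) 0"
  by (cases "z = 0") (auto simp: homogeneous_def Const_def)

lemma homogeneous_X: "homogeneous (X i) 1"
  by (simp add: homogeneous_def X_def lookup_single when_def)

lemma homogeneous_add: "homogeneous f d \<Longrightarrow> homogeneous g d \<Longrightarrow> homogeneous (f + g) d"
  using keys_add[of f g] unfolding homogeneous_def by blast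

lemma homogeneous_sum: "(\<And>x. x \<in> A \<Longrightarrow> homogeneous (f x) d) \<Longrightarrow> homogeneous (sum f A) d"
  by (induction A rule: infinite_finite_induct) (auto intro: homogeneous_add)

lemma homogeneous_mult:
  assumes "homogeneous f d" and "homogeneous g e"
  shows "homogeneous (f * g) (d + e)"
  unfolding homogeneous_def
proof
  fix m assume "m \<in> Poly_Mapping.keys (f * g)"
  then obtain a b where "m = a + b" "a \<in> Poly_Mapping.keys f" "b \<in> Poly_Mapping.keys g"
    using keys_mult[of f g] by blast
  then show "(\<Sum>i\<in>UNIV. Poly_Mapping.lookup m i) = d + e"
    using assms by (auto simp: homogeneous_def lookup_add sum.distrib)
qed

lemma homogeneous_power: "homogeneous f d \<Longrightarrow> homogeneous (f ^ n) (d * n)"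
  by (induction n) (use homogeneous_mult in fastforce)+

lemma homogeneous_prod:
  "(\<And>x. x \<in> A \<Longrightarrow> homogeneous (f x) d) \<Longrightarrow> homogeneous (prod f A) (d * card A)"
proof (induction A rule: infinite_finite_induct)
  case (insert x A)
  then show ?case using homogeneous_mult[of "f x" d "prod f A" "d * card A"] by simp
qed auto

lemma homogeneous_degree_0:
  assumes "homogeneous f 0"
  shows "f = Const (Poly_Mapping.lookup f 0)"
proof -
  have "m = 0" if "m \<in> Poly_Mapping.keys f" for m
    using assms that by (intro poly_mapping_eqI) (auto simp: homogeneous_def)
  then show ?thesis
    by (intro poly_mapping_eqI) (metis Const_def in_keys_iff lookup_single_eq lookup_single_not_eq)
qed

lemma homogeneous_pdiff:
  assumes "homogeneous f (Suc d)"
  shows "homogeneous (pdiff i f) d"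
  unfolding pdiff_def
proof (rule homogeneous_sum)
  fix m assume m: "m \<in> Poly_Mapping.keys f"
  show "homogeneous (Poly_Mapping.single (m - Poly_Mapping.single i 1)
      (of_nat (Poly_Mapping.lookup m i) * Poly_Mapping.lookup f m)) d"
  proof (cases "Poly_Mapping.lookup m i = 0")
    case False
    have "(\<Sum>j\<in>UNIV. Poly_Mapping.lookup ((m - Poly_Mapping.single i 1) + Poly_Mapping.single i 1) j) = Suc d"
      using assms m unfolding diff_single_add_single[OF False] homogeneous_def by blast
    then have "(\<Sum>j\<in>UNIV. Poly_Mapping.lookup (m - Poly_Mapping.single i 1) j) = d"
      by (simp add: lookup_add sum.distrib lookup_single when_def)
    then show ?thesis by (simp add: homogeneous_def)
  qed simp
qed

text \<open>The operator \<open>X i * pdiff i\<close> multiplies each monomial by its exponent at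
  \<open>i\<close>, and these exponents add up to \<open>d\<close>.\<close>

lemma Euler_homogeneous:
  assumes "homogeneous f d"
  shows "(\<Sum>i\<in>UNIV. X i * pdiff i f) = of_nat d * f"
proof -
  have *: "X i * pdiff i (Poly_Mapping.single m z) =
      Poly_Mapping.single m (of_nat (Poly_Mapping.lookup m i) * z)" for i m z
    by (simp add: X_def single_mult_pdiff_single add.commute[of "Poly_Mapping.single i (Suc 0)"])
  have **: "(\<Sum>i\<in>UNIV. X i * pdiff i (Poly_Mapping.single m z)) = of_nat d * Poly_Mapping.single m z"
    if "(\<Sum>i\<in>UNIV. Poly_Mapping.lookup m i) = d" for m z
  proof -
    have "(\<Sum>i\<in>UNIV. X i * pdiff i (Poly_Mapping.single m z)) =
       Poly_Mapping.single m (of_nat d * z)"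
      unfolding * that[symmetric] sum_3 by (simp add: single_add[symmetric] distrib_right)
    also have "\<dots> = of_nat d * Poly_Mapping.single m z"
      by (metis (no_types) add_0 mult_single single_of_nat)
    finally show ?thesis .
  qed
  have "(\<Sum>i\<in>UNIV. X i * pdiff i f) =
     (\<Sum>i\<in>UNIV. X i * pdiff i (\<Sum>m\<in>Poly_Mapping.keys f. Poly_Mapping.single m (Poly_Mapping.lookup f m)))"
    by (simp add: poly_mapping_sum_single)
  also have "\<dots> = (\<Sum>m\<in>Poly_Mapping.keys f.
      (\<Sum>i\<in>UNIV. X i * pdiff i (Poly_Mapping.single m (Poly_Mapping.lookup f m))))"
    by (simp add: pdiff_sum sum_distrib_left) (rule sum.swap)
  also have "\<dots> = (\<Sum>m\<in>Poly_Mapping.keys f. of_nat d * Poly_Mapping.single m (Poly_Mapping.lookup f m))"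
    using assms by (intro sum.cong refl **) (auto simp: homogeneous_def)
  also have "\<dots> = of_nat d * f"
    by (simp add: sum_distrib_left[symmetric] poly_mapping_sum_single)
  finally show ?thesis .
qed

text \<open>\<open>C\<close> is the Hessian matrix, constant because second derivatives have degree
  0. Euler's formula is applied first to the gradient, of degree 1, and then to
  \<open>f\<close>.\<close>

lemma quadratic_form:
  assumes "homogeneous f 2"
  obtains C :: "3 \<Rightarrow> 3 \<Rightarrow> complex" where "\<And>i j. C i j = C j i"
    and "\<And>j. pdiff j f = (\<Sum>i\<in>UNIV. X i * Const (C i j))"
    and "2 * f = (\<Sum>j\<in>UNIV. X j * (\<Sum>i\<in>UNIV. X i * Const (C i j)))"
proof -
  define C where "C i j = Poly_Mapping.lookup (pdiff i (pdiff j f)) 0" for i j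
  have 1: "homogeneous (pdiff j f) 1" for j
    using assms homogeneous_pdiff[of f 1 j] by (simp add: numeral_2_eq_2)
  then have 0: "pdiff i (pdiff j f) = Const (C i j)" for i j
    unfolding C_def using homogeneous_pdiff[of "pdiff j f" 0 i] by (intro homogeneous_degree_0) simp
  have "pdiff j f = (\<Sum>i\<in>UNIV. X i * Const (C i j))" for j
    using Euler_homogeneous[OF 1[of j]] by (simp add: 0)
  moreover from this have "2 * f = (\<Sum>j\<in>UNIV. X j * (\<Sum>i\<in>UNIV. X i * Const (C i j)))"
    using Euler_homogeneous[OF assms] by simp
  moreover have "C i j = C j i" for i j
    by (simp add: C_def pdiff_commute)
  ultimately show ?thesis using that by blast
qed

subsection \<open>Saturated ideals\<close>

lemma module_times: "module ((*) :: cpoly3 \<Rightarrow> cpoly3 \<Rightarrow> cpoly3)"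
  by unfold_locales (auto simp: algebra_simps)

lemmas ideal_gen_zero = module.span_zero[OF module_times, folded ideal_gen_def]
lemmas ideal_gen_base = module.span_base[OF module_times, folded ideal_gen_def]
lemmas ideal_gen_add = module.span_add[OF module_times, folded ideal_gen_def]
lemmas ideal_gen_neg = module.span_neg[OF module_times, folded ideal_gen_def]
lemmas ideal_gen_sum = module.span_sum[OF module_times, folded ideal_gen_def]
lemmas ideal_gen_scale = module.span_scale[OF module_times, folded ideal_gen_def]

lemma ideal_gen_minimal:
  assumes "B \<subseteq> S" and "0 \<in> S" and "\<And>f g. f \<in> S \<Longrightarrow> g \<in> S \<Longrightarrow> f + g \<in> S"
    and "\<And>f g. g \<in> S \<Longrightarrow> f * g \<in> S"
  shows "ideal_gen B \<subseteq> S"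
  unfolding ideal_gen_def using assms
  by (intro module.span_minimal[OF module_times]) (auto simp: module.subspace_def[OF module_times])

lemma ideal_gen_subset: "B \<subseteq> ideal_gen C \<Longrightarrow> ideal_gen B \<subseteq> ideal_gen C"
  by (rule ideal_gen_minimal) (auto intro: ideal_gen_zero ideal_gen_add ideal_gen_scale)

lemma ideal_gen_singleton: "ideal_gen {f} = {h. f dvd h}"
  unfolding ideal_gen_def module.span_singleton[OF module_times] by (auto simp: dvd_def mult.commute)

text \<open>For fixed \<open>u\<close> in \<open>A\<close>, the multipliers that send
  \<open>u\<close> into the product ideal form an ideal containing \<open>B\<close>; the same
  argument in the other factor then passes from \<open>A\<close> to the ideal it generates.\<close>

lemma ideal_gen_mult:
  assumes "f \<in> ideal_gen A" and "g \<in> ideal_gen B"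
  shows "f * g \<in> ideal_gen {u * v | u v. u \<in> A \<and> v \<in> B}" (is "_ \<in> ?K")
proof -
  have "ideal_gen B \<subseteq> {g. u * g \<in> ?K}" if "u \<in> A" for u
    using that by (intro ideal_gen_minimal)
      (auto intro: ideal_gen_zero ideal_gen_base ideal_gen_add ideal_gen_scale
        simp: distrib_left mult.left_commute[of u])
  then have "u * g \<in> ?K" if "u \<in> A" for u
    using that assms(2) by blast
  then have "ideal_gen A \<subseteq> {f. f * g \<in> ?K}"
    by (intro ideal_gen_minimal)
      (auto intro: ideal_gen_zero ideal_gen_add ideal_gen_scale simp: distrib_right mult.assoc)
  then show ?thesis using assms(1) by blast
qed

lemma power_mult_mem_mono:
  assumes "X i ^ k * f \<in> ideal_gen B" and "k \<le> n"
  shows "X i ^ n * f \<in> ideal_gen B"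
proof -
  have "X i ^ n * f = X i ^ (n - k) * (X i ^ k * f)"
    using assms(2) by (simp add: power_add[symmetric] mult.assoc[symmetric])
  then show ?thesis using assms(1) by (metis ideal_gen_scale)
qed

lemma mem_subscheme: "f \<in> subscheme B \<longleftrightarrow> (\<exists>k. \<forall>i. X i ^ k * f \<in> ideal_gen B)"
  by (simp add: subscheme_def saturation_def)

text \<open>Saturation asks for one exponent that serves all variables; the sum of the individual
  exponents does.\<close>

lemma mem_subscheme_pointwise:
  assumes "\<And>i. \<exists>k. X i ^ k * f \<in> ideal_gen B"
  shows "f \<in> subscheme B"
proof -
  obtain k where k: "\<And>i. X i ^ k i * f \<in> ideal_gen B" using assms by metis
  have "X i ^ (\<Sum>j\<in>UNIV. k j) * f \<in> ideal_gen B" for i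
    by (rule power_mult_mem_mono[OF k]) (auto intro: member_le_sum)
  then show ?thesis unfolding mem_subscheme by blast
qed

lemma subset_subscheme: "B \<subseteq> subscheme B"
  unfolding mem_subscheme subset_iff by (intro allI impI exI[of _ 0]) (simp add: ideal_gen_base)

lemma subscheme_mono: "B \<subseteq> ideal_gen C \<Longrightarrow> subscheme B \<subseteq> subscheme C"
  using ideal_gen_subset[of B C] unfolding mem_subscheme subset_iff by blast

lemma subscheme_zero: "0 \<in> subscheme B"
  by (simp add: mem_subscheme ideal_gen_zero)

lemma subscheme_add:
  assumes "f \<in> subscheme B" and "g \<in> subscheme B"
  shows "f + g \<in> subscheme B"
proof -
  obtain k m where "\<And>i. X i ^ k * f \<in> ideal_gen B" "\<And>i. X i ^ m * g \<in> ideal_gen B"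
    using assms unfolding mem_subscheme by metis
  then have "X i ^ (k + m) * (f + g) \<in> ideal_gen B" for i
    unfolding distrib_left by (intro ideal_gen_add) (blast intro: power_mult_mem_mono le_add1 le_add2)+
  then show ?thesis unfolding mem_subscheme by blast
qed

lemma subscheme_scale: "g \<in> subscheme B \<Longrightarrow> f * g \<in> subscheme B"
  unfolding mem_subscheme by (metis ideal_gen_scale mult.left_commute)

lemma ideal_gen_subset_subscheme: "C \<subseteq> subscheme B \<Longrightarrow> ideal_gen C \<subseteq> subscheme B"
  by (intro ideal_gen_minimal) (blast intro: subscheme_zero subscheme_add subscheme_scale)+

text \<open>Saturating twice gives nothing new: for each variable the two exponents add up.\<close>

lemma subscheme_subset:
  assumes "C \<subseteq> subscheme B"
  shows "subscheme C \<subseteq> subscheme B"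
proof
  fix f assume "f \<in> subscheme C"
  then obtain k where k: "\<And>i. X i ^ k * f \<in> subscheme B"
    using ideal_gen_subset_subscheme[OF assms] unfolding mem_subscheme[of f C] by blast
  have "\<exists>n. X i ^ n * f \<in> ideal_gen B" for i
  proof -
    obtain n where "X i ^ n * (X i ^ k * f) \<in> ideal_gen B"
      using k[of i] unfolding mem_subscheme by blast
    then have "X i ^ (n + k) * f \<in> ideal_gen B" by (simp add: power_add mult.assoc)
    then show ?thesis by blast
  qed
  then show "f \<in> subscheme B" by (rule mem_subscheme_pointwise)
qed

text \<open>Allows sums of schemes to be computed on generators: the powers of a variable that clear
  the two factors separately multiply to one that clears the product.\<close>

lemma scheme_sum_subscheme:
  "scheme_sum (subscheme A) (subscheme B) = subscheme {u * v | u v. u \<in> A \<and> v \<in> B}"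
    (is "_ = subscheme ?K")
proof
  have "u * v \<in> subscheme ?K" if u: "u \<in> subscheme A" and v: "v \<in> subscheme B" for u v
  proof -
    obtain k m where k: "\<And>i. X i ^ k * u \<in> ideal_gen A" and m: "\<And>i. X i ^ m * v \<in> ideal_gen B"
      using u v unfolding mem_subscheme by metis
    have "X i ^ (k + m) * (u * v) \<in> ideal_gen ?K" for i
      using ideal_gen_mult[OF k m] by (simp add: power_add mult_ac)
    then show ?thesis unfolding mem_subscheme by blast
  qed
  then show "scheme_sum (subscheme A) (subscheme B) \<subseteq> subscheme ?K"
    unfolding scheme_sum_def by (intro subscheme_subset) blast
next
  show "subscheme ?K \<subseteq> scheme_sum (subscheme A) (subscheme B)"
    unfolding scheme_sum_def using subset_subscheme[of A] subset_subscheme[of B]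
    by (intro subscheme_mono) (blast intro: ideal_gen_base)
qed

lemma scheme_sum_plane_curve: "scheme_sum (plane_curve f) (plane_curve g) = plane_curve (f * g)"
  unfolding plane_curve_def scheme_sum_subscheme by simp

lemma subscheme_Const_mult:
  assumes "z \<noteq> 0"
  shows "subscheme ((\<lambda>f. Const z * f) ` B) = subscheme B"
proof
  show "subscheme ((\<lambda>f. Const z * f) ` B) \<subseteq> subscheme B"
    by (intro subscheme_mono) (auto intro: ideal_gen_scale ideal_gen_base)
  have "f \<in> ideal_gen ((\<lambda>f. Const z * f) ` B)" if "f \<in> B" for f
    using ideal_gen_scale[OF ideal_gen_base[OF imageI[OF that, of "\<lambda>f. Const z * f"]], of "Const (inverse z)"]
    by (simp add: Const_inverse_mult[OF assms])
  then show "subscheme B \<subseteq> subscheme ((\<lambda>f. Const z * f) ` B)"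
    by (intro subscheme_mono) blast
qed

subsection \<open>Linear forms and the ideal of a point\<close>

text \<open>The 2x2 minors of the matrix with rows \<open>X\<close> and \<open>a\<close>; for
  nonzero \<open>a\<close> they cut out the point \<open>a\<close>.\<close>

definition minor :: "complex^3 \<Rightarrow> 3 \<Rightarrow> 3 \<Rightarrow> cpoly3" where
  "minor a i j = X i * Const (a $ j) - X j * Const (a $ i)"

definition point_minors :: "complex^3 \<Rightarrow> cpoly3 set" where
  "point_minors a = {minor a i j | i j. i < j}"

lemma pdiff_linear_form: "pdiff j (linear_form a) = Const (a $ j)"
  by (simp add: linear_form_def pdiff_sum pdiff_Const_mult pdiff_X if_distrib cong: if_cong)

lemma eigenscheme_linear_form: "eigenscheme (linear_form a) = subscheme (point_minors a)"
  by (simp add: eigenscheme_def point_minors_def pdiff_linear_form minor_def)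

lemma minor_mem: "minor a i j \<in> ideal_gen (point_minors a)"
proof (cases i j rule: linorder_cases)
  case less
  then show ?thesis by (intro ideal_gen_base) (auto simp: point_minors_def)
next
  case equal
  then show ?thesis by (simp add: minor_def ideal_gen_zero)
next
  case greater
  then have "minor a j i \<in> ideal_gen (point_minors a)"
    by (intro ideal_gen_base) (auto simp: point_minors_def)
  from ideal_gen_neg[OF this] show ?thesis by (simp add: minor_def)
qed

text \<open>Up to the unit \<open>z\<close>, the equations of the eigenscheme are the products of
  \<open>h\<close> with the generators of the ideal of the point.\<close>

lemma eigenscheme_eq_scheme_sum:
  assumes "z \<noteq> 0"
    and "\<And>i j. X i * pdiff j f - X j * pdiff i f = Const z * (h * minor a i j)"
  shows "eigenscheme f = scheme_sum (plane_curve h) (eigenscheme (linear_form a))"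
proof -
  have "{X i * pdiff j f - X j * pdiff i f | i j. i < j} =
      (\<lambda>f. Const z * f) ` {u * v | u v. u \<in> {h} \<and> v \<in> point_minors a}"
    unfolding assms(2) point_minors_def by blast
  then show ?thesis
    unfolding eigenscheme_def[of f] eigenscheme_linear_form plane_curve_def scheme_sum_subscheme
    by (simp only: subscheme_Const_mult[OF assms(1)])
qed

section \<open>Congruences modulo an ideal, and unions with a point\<close>

lemma ideal_cong_mult:
  assumes "f - f' \<in> ideal_gen B" and "g - g' \<in> ideal_gen B"
  shows "f * g - f' * g' \<in> ideal_gen B"
proof -
  have "f * g - f' * g' = f * (g - g') + g' * (f - f')" by (simp add: algebra_simps)
  then show ?thesis using assms by (simp add: ideal_gen_add ideal_gen_scale)
qed

lemma ideal_cong_power: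
  "f - f' \<in> ideal_gen B \<Longrightarrow> f ^ n - f' ^ n \<in> ideal_gen B"
  by (induction n) (auto intro: ideal_cong_mult ideal_gen_zero)

lemma ideal_cong_prod:
  "(\<And>x. x \<in> A \<Longrightarrow> f x - g x \<in> ideal_gen B) \<Longrightarrow> prod f A - prod g A \<in> ideal_gen B"
  by (induction A rule: infinite_finite_induct) (auto intro: ideal_cong_mult ideal_gen_zero)

text \<open>On the line through the point \<open>a\<close>, a form of degree \<open>d\<close> is determined by its value at \<open>a\<close>.\<close>

lemma homogeneous_cong_point_minors:
  assumes "homogeneous f d"
  shows "Const (eval_at f a) * X j ^ d - Const (a $ j) ^ d * f \<in> ideal_gen (point_minors a)"
proof -
  have mono: "Const (\<Prod>i\<in>UNIV. (a $ i) ^ Poly_Mapping.lookup m i) * X j ^ d - Const (a $ j) ^ d * monomial m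
      \<in> ideal_gen (point_minors a)" if m: "m \<in> Poly_Mapping.keys f" for m
  proof -
    have d: "d = (\<Sum>i\<in>UNIV. Poly_Mapping.lookup m i)"
      using assms m by (simp add: homogeneous_def)
    have pw: "Const (z ^ k) = Const z ^ k" for z k
      by (induction k) (auto simp: Const_mult)
    \<comment> \<open>The minors say that \<open>a $ i * X j\<close> and \<open>a $ j * X i\<close>
      are congruent. Taking powers and multiplying over \<open>i\<close> collects the total degree
      \<open>d\<close> at \<open>X j\<close> and at \<open>a $ j\<close>.\<close>
    have "(\<Prod>i\<in>UNIV. (Const (a $ i) * X j) ^ Poly_Mapping.lookup m i) -
        (\<Prod>i\<in>UNIV. (Const (a $ j) * X i) ^ Poly_Mapping.lookup m i) \<in> ideal_gen (point_minors a)"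
      using minor_mem[of a j] by (intro ideal_cong_prod ideal_cong_power) (simp add: minor_def mult.commute)
    then show ?thesis
      by (simp add: d Const_prod pw power_mult_distrib prod.distrib power_sum monomial_def)
  qed
  have "Const (eval_at f a) * X j ^ d - Const (a $ j) ^ d * f =
     Const (eval_at f a) * X j ^ d - Const (a $ j) ^ d *
       (\<Sum>m\<in>Poly_Mapping.keys f. Const (Poly_Mapping.lookup f m) * monomial m)"
    by (simp add: single_eq_Const_monomial[symmetric] poly_mapping_sum_single)
  also have "\<dots> = (\<Sum>m\<in>Poly_Mapping.keys f. Const (Poly_Mapping.lookup f m) *
      (Const (\<Prod>i\<in>UNIV. (a $ i) ^ Poly_Mapping.lookup m i) * X j ^ d - Const (a $ j) ^ d * monomial m))"
    by (simp add: eval_at_def Const_sum Const_mult sum_distrib_left sum_distrib_right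
        sum_subtractf right_diff_distrib mult_ac)
  also have "\<dots> \<in> ideal_gen (point_minors a)"
    by (intro ideal_gen_sum ideal_gen_scale mono)
  finally show ?thesis .
qed

text \<open>A form not vanishing at \<open>a\<close> is invertible near that point. So if
  \<open>f * w\<close> lies in the ideal of the point, then \<open>w\<close> does too after
  multiplication by powers of the variables, and the intersection of the ideals is no larger than
  the saturated product.\<close>

lemma scheme_union_point:
  assumes "homogeneous f d" and "eval_at f a \<noteq> 0"
  shows "scheme_union (plane_curve f) (eigenscheme (linear_form a)) =
    scheme_sum (plane_curve f) (eigenscheme (linear_form a))"
proof -
  let ?M = "point_minors a" and ?K = "{u * v | u v. u \<in> {f} \<and> v \<in> point_minors a}"
  have "subscheme {f} \<inter> subscheme ?M \<subseteq> subscheme ?K"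
  proof
    fix h assume "h \<in> subscheme {f} \<inter> subscheme ?M"
    then obtain k m where k: "\<And>i. X i ^ k * h \<in> ideal_gen {f}" and m: "\<And>i. X i ^ m * h \<in> ideal_gen ?M"
      unfolding mem_subscheme Int_iff by blast
    have "X i ^ (d + (k + m)) * h \<in> ideal_gen ?K" for i
    proof -
      have "X i ^ (k + m) * h \<in> ideal_gen {f}"
        by (rule power_mult_mem_mono[OF k]) simp
      then obtain w where w: "X i ^ (k + m) * h = f * w"
        by (auto simp: ideal_gen_singleton dvd_def)
      have fw: "f * w \<in> ideal_gen ?M"
        unfolding w[symmetric] by (rule power_mult_mem_mono[OF m]) simp
      \<comment> \<open>The two terms containing \<open>f * w\<close> cancel, which leaves the
        nonzero constant \<open>eval_at f a\<close> times \<open>X i ^ d * w\<close>.\<close>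
      have "w * (Const (eval_at f a) * X i ^ d - Const (a $ i) ^ d * f) + Const (a $ i) ^ d * (f * w) \<in> ideal_gen ?M"
        using ideal_gen_add[OF ideal_gen_scale[OF homogeneous_cong_point_minors[OF assms(1)]] ideal_gen_scale[OF fw]] .
      then have "Const (eval_at f a) * (X i ^ d * w) \<in> ideal_gen ?M"
        by (simp add: algebra_simps)
      from ideal_gen_scale[OF this, of "Const (inverse (eval_at f a))"]
      have "X i ^ d * w \<in> ideal_gen ?M"
        by (simp add: Const_inverse_mult[OF assms(2)])
      from ideal_gen_mult[OF ideal_gen_base[of f "{f}"] this]
      have "f * (X i ^ d * w) \<in> ideal_gen ?K" by simp
      also have "f * (X i ^ d * w) = X i ^ (d + (k + m)) * h"
        unfolding power_add[of _ d] mult.assoc w by (simp add: mult_ac)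
      finally show ?thesis .
    qed
    then show "h \<in> subscheme ?K" unfolding mem_subscheme by blast
  qed
  moreover have "?K \<subseteq> ideal_gen {f}"
    by (auto simp: ideal_gen_singleton)
  moreover have "?K \<subseteq> ideal_gen ?M"
    by (auto intro: ideal_gen_scale ideal_gen_base)
  ultimately show ?thesis
    unfolding scheme_union_def plane_curve_def eigenscheme_linear_form scheme_sum_subscheme
    using subscheme_mono[of ?K "{f}"] subscheme_mono[of ?K ?M] by blast
qed

text \<open>Eliminating a variable is a ring endomorphism \<open>\<phi>\<close> with \<open>f \<equiv> \<phi> f\<close> modulo the linear form, so
  that the linear form divides exactly the kernel of \<open>\<phi>\<close>.\<close>

lemma linear_form_prime:
  assumes "a \<noteq> 0" and "linear_form a dvd f * g"
  shows "linear_form a dvd f \<or> linear_form a dvd g"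
proof -
  obtain k where k: "a $ k \<noteq> 0"
    using assms(1) by (auto simp: vec_eq_iff)
  \<comment> \<open>The equation of the line is solved for \<open>X k\<close>: the image
    \<open>v k\<close> is a form in the other two variables.\<close>
  define v where "v i = X i - (if i = k then Const (inverse (a $ k)) * linear_form a else 0)" for i
  define \<phi> where "\<phi> = poly_subst Const v"
  have cong: "linear_form a dvd f - \<phi> f" for f
  proof (induction f rule: cpoly3_induct)
    case (add f g)
    have "f + g - \<phi> (f + g) = (f - \<phi> f) + (g - \<phi> g)"
      by (simp add: \<phi>_def substitution.subst_add)
    then show ?case using add by (metis dvd_add)
  next
    case (mult f g)
    have "f * g - \<phi> (f * g) = (f - \<phi> f) * g + \<phi> f * (g - \<phi> g)"
      by (simp add: \<phi>_def substitution.subst_mult algebra_simps)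
    then show ?case using mult by simp
  qed (auto simp: \<phi>_def v_def)
  have "\<phi> (linear_form a) = (\<Sum>i\<in>UNIV. Const (a $ i) * v i)"
    by (simp add: \<phi>_def linear_form_def substitution.subst_sum substitution.subst_mult)
  also have "\<dots> = linear_form a - (\<Sum>i\<in>UNIV. if i = k then Const (a $ k) * (Const (inverse (a $ k)) * linear_form a) else 0)"
    unfolding linear_form_def[of a] v_def right_diff_distrib sum_subtractf
    by (intro arg_cong2[of _ _ _ _ "(-)"] sum.cong) auto
  also have "\<dots> = 0"
    using k by (simp add: mult.left_commute[of "Const (a $ k)"] Const_inverse_mult)
  finally have \<phi>_l: "\<phi> (linear_form a) = 0" .
  have "\<phi> (f * g) = 0"
    using assms(2) \<phi>_l by (metis \<phi>_def dvdE mult_zero_left substitution.subst_mult)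
  \<comment> \<open>The polynomial ring has no zero divisors, so one factor lies in the
    kernel.\<close>
  then have "\<phi> f = 0 \<or> \<phi> g = 0"
    by (simp add: \<phi>_def substitution.subst_mult)
  then show ?thesis using cong[of f] cong[of g] by auto
qed

text \<open>The linear form is prime and does not divide \<open>g\<close>, so a multiple of
  \<open>g\<close> that it divides is a multiple of the product.\<close>

lemma scheme_union_line:
  assumes "a \<noteq> 0" and "\<not> linear_form a dvd g"
  shows "scheme_union (plane_curve (linear_form a)) (plane_curve g) =
    scheme_sum (plane_curve (linear_form a)) (plane_curve g)"
proof -
  let ?l = "linear_form a"
  have "subscheme {?l} \<inter> subscheme {g} \<subseteq> subscheme {?l * g}"
  proof
    fix h assume "h \<in> subscheme {?l} \<inter> subscheme {g}"
    then obtain k m where k: "\<And>i. X i ^ k * h \<in> ideal_gen {?l}" and m: "\<And>i. X i ^ m * h \<in> ideal_gen {g}"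
      unfolding mem_subscheme Int_iff by blast
    have "X i ^ (k + m) * h \<in> ideal_gen {?l * g}" for i
    proof -
      have "?l dvd X i ^ (k + m) * h" "g dvd X i ^ (k + m) * h"
        using power_mult_mem_mono[OF k[of i], of "k + m"] power_mult_mem_mono[OF m[of i], of "k + m"]
        by (simp_all add: ideal_gen_singleton)
      then obtain w where w: "X i ^ (k + m) * h = g * w" and "?l dvd g * w"
        by (metis dvd_def)
      then have "?l dvd w" using linear_form_prime[OF assms(1)] assms(2) by blast
      then show ?thesis by (simp add: ideal_gen_singleton w mult.commute[of _ g])
    qed
    then show "h \<in> subscheme {?l * g}" unfolding mem_subscheme by blast
  qed
  moreover have "subscheme {?l * g} \<subseteq> subscheme {?l}" "subscheme {?l * g} \<subseteq> subscheme {g}"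
    by (intro subscheme_mono; simp add: ideal_gen_singleton)+
  ultimately show ?thesis
    unfolding scheme_sum_plane_curve unfolding scheme_union_def plane_curve_def by blast
qed

subsection \<open>Binary forms in the conic and the squared line\<close>

text \<open>The binary form \<open>u^n * p(v/u)\<close>, with coefficients of \<open>p\<close>
  beyond \<open>n\<close> cut off. The form degree \<open>n\<close> is a separate argument because a
  form divisible by \<open>u\<close> has larger degree than its polynomial.\<close>

definition homogenize :: "cpoly3 \<Rightarrow> cpoly3 \<Rightarrow> nat \<Rightarrow> complex poly \<Rightarrow> cpoly3" where
  "homogenize u v n p = (\<Sum>i\<le>n. Const (coeff p i) * (v ^ i * u ^ (n - i)))"

lemma homogenize_add: "homogenize u v n (p + q) = homogenize u v n p + homogenize u v n q"
  by (simp add: homogenize_def Const_add distrib_right sum.distrib)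

lemma homogenize_smult: "homogenize u v n (smult z p) = Const z * homogenize u v n p"
  by (simp add: homogenize_def Const_mult sum_distrib_left mult.assoc)

lemma homogenize_pCons_0: "homogenize u v (Suc n) (pCons 0 p) = v * homogenize u v n p"
  unfolding homogenize_def sum.atMost_Suc_shift by (simp add: sum_distrib_left mult_ac)

lemma homogenize_Suc:
  assumes "degree p \<le> n"
  shows "homogenize u v (Suc n) p = u * homogenize u v n p"
proof -
  have "coeff p (Suc n) = 0" using assms by (intro coeff_eq_0) simp
  then show ?thesis
    unfolding homogenize_def sum_distrib_left sum.atMost_Suc
    by (simp, intro sum.cong refl) (simp add: Suc_diff_le mult_ac)
qed

lemma homogenize_mult_linear:
  assumes "degree p \<le> n"
  shows "homogenize u v (Suc n) ([:r, 1:] * p) = (v + Const r * u) * homogenize u v n p"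
  using homogenize_Suc[OF assms, of u v]
  by (simp add: homogenize_add homogenize_smult homogenize_pCons_0 algebra_simps)

lemma degree_prod_linear: "finite A \<Longrightarrow> degree (\<Prod>k\<in>A. [:r k, 1::complex:]) = card A"
  by (induction A rule: finite_induct) (auto simp: degree_mult_eq simp del: mult_pCons_left)

lemma homogenize_prod_linear:
  "finite A \<Longrightarrow> homogenize u v (card A) (\<Prod>k\<in>A. [:r k, 1:]) = (\<Prod>k\<in>A. v + Const (r k) * u)"
proof (induction A rule: finite_induct)
  case (insert x A)
  then have "degree (\<Prod>k\<in>A. [:r k, 1:]) \<le> card A" by (simp add: degree_prod_linear)
  from homogenize_mult_linear[OF this, of u v "r x"] insert show ?case
    by (simp del: mult_pCons_left)
qed (simp add: homogenize_def)

text \<open>The fundamental theorem of algebra splits \<open>p\<close>. Homogenizing to exactly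
  \<open>degree p\<close> leaves no bare factor \<open>u\<close>, so each linear factor contains
  \<open>v\<close>.\<close>

lemma homogenize_factorization:
  obtains r :: "nat \<Rightarrow> complex"
  where "homogenize u v (degree p) p = Const (lead_coeff p) * (\<Prod>k=1..degree p. v + Const (r k) * u)"
proof -
  obtain root where root: "smult (lead_coeff p) (\<Prod>i<degree p. [:- root i, 1:]) = p"
    by (rule complex_poly_decompose')
  have "homogenize u v (degree p) p =
      homogenize u v (degree p) (smult (lead_coeff p) (\<Prod>i<degree p. [:- root i, 1:]))"
    by (simp only: root)
  also have "\<dots> = Const (lead_coeff p) * (\<Prod>i<degree p. v + Const (- root i) * u)"
    using homogenize_prod_linear[of "{..<degree p}" u v "\<lambda>i. - root i"] by (simp add: homogenize_smult)
  also have "(\<Prod>i<degree p. v + Const (- root i) * u) =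
      (\<Prod>k=1..degree p. v + Const (- root (k - 1)) * u)"
    by (rule prod.reindex_bij_witness[of _ "\<lambda>k. k - 1" Suc]) auto
  finally show ?thesis by (rule that)
qed

section \<open>The derivations that define the eigenscheme\<close>

definition rotation :: "3 \<Rightarrow> 3 \<Rightarrow> cpoly3 \<Rightarrow> cpoly3" where
  "rotation i j f = X i * pdiff j f - X j * pdiff i f"

lemma rotation_add: "rotation i j (f + g) = rotation i j f + rotation i j g"
  and rotation_mult: "rotation i j (f * g) = f * rotation i j g + rotation i j f * g"
  and rotation_Const [simp]: "rotation i j (Const z) = 0"
  and rotation_one [simp]: "rotation i j 1 = 0"
  and rotation_zero [simp]: "rotation i j 0 = 0"
  by (simp_all add: rotation_def pdiff_add pdiff_mult algebra_simps)

lemma rotation_power: "rotation i j (f ^ n) = of_nat n * (f ^ (n - 1) * rotation i j f)"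
proof (induction n)
  case (Suc n)
  then show ?case by (cases n) (simp_all add: rotation_mult algebra_simps)
qed simp

lemma rotation_sum: "rotation i j (sum f A) = (\<Sum>x\<in>A. rotation i j (f x))"
  by (induction A rule: infinite_finite_induct) (auto simp: rotation_add)

lemma rotation_linear_form: "rotation i j (linear_form a) = minor a i j"
  by (simp add: rotation_def pdiff_linear_form minor_def)

lemma pdiff_isotropic_conic: "pdiff j isotropic_conic = 2 * X j"
proof -
  have "pdiff j isotropic_conic = (\<Sum>i\<in>UNIV. if i = j then 2 * X j else 0)"
    unfolding isotropic_conic_def pdiff_sum power2_eq_square pdiff_mult
    by (intro sum.cong) (auto simp: pdiff_X)
  then show ?thesis by simp
qed

text \<open>These derivations are the infinitesimal rotations, which preserve the sum of
  squares.\<close>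

lemma rotation_isotropic_conic: "rotation i j isotropic_conic = 0"
  by (simp add: rotation_def pdiff_isotropic_conic)

text \<open>Chain rule: as \<open>u\<close> is killed, only the derivative in \<open>v\<close>
  survives, and it corresponds to \<open>pderiv p\<close> in form degree one less.\<close>

lemma rotation_homogenize:
  assumes "rotation i j u = 0"
  shows "rotation i j (homogenize u v (Suc n) p) = homogenize u v n (pderiv p) * rotation i j v"
proof -
  have monom: "rotation i j (Const z * (v ^ k * u ^ m)) = Const z * (of_nat k * (v ^ (k - 1) * u ^ m)) * rotation i j v"
    for z k m by (simp add: rotation_mult rotation_power assms mult_ac)
  have "rotation i j (homogenize u v (Suc n) p) =
      (\<Sum>k\<le>Suc n. Const (coeff p k) * (of_nat k * (v ^ (k - 1) * u ^ (Suc n - k))) * rotation i j v)"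
    unfolding homogenize_def rotation_sum monom ..
  also have "\<dots> = homogenize u v n (pderiv p) * rotation i j v"
    unfolding homogenize_def sum.atMost_Suc_shift sum_distrib_right
    by (simp add: coeff_pderiv Const_mult Const_add Const_of_nat algebra_simps)
  finally show ?thesis .
qed

subsection \<open>Conics tangent to the isotropic conic at two points\<close>

lemma eval_at_linear_form: "eval_at (linear_form w) p = (\<Sum>i\<in>UNIV. w $ i * p $ i)"
  by (simp add: linear_form_def)

lemma eval_at_isotropic_conic: "eval_at isotropic_conic p = (\<Sum>i\<in>UNIV. (p $ i)\<^sup>2)"
  by (simp add: isotropic_conic_def)

lemma parallel_vectors:
  fixes x y :: "complex^'n"
  assumes "y \<noteq> 0" and "\<And>i j. x $ i * y $ j = x $ j * y $ i"
  obtains t where "x = t *s y"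
proof -
  obtain k where k: "y $ k \<noteq> 0" using assms(1) by (auto simp: vec_eq_iff)
  have "x $ i = (x $ k / y $ k) * y $ i" for i
    using assms(2)[of i k] k by (simp add: field_simps)
  then have "x = (x $ k / y $ k) *s y"
    unfolding vec_eq_iff vector_smult_component by blast
  then show ?thesis by (rule that)
qed

lemma parallel_vectors_3:
  fixes x y :: "complex^3"
  assumes "y \<noteq> 0" and "x $ 1 * y $ 2 = x $ 2 * y $ 1" and "x $ 1 * y $ 3 = x $ 3 * y $ 1"
    and "x $ 2 * y $ 3 = x $ 3 * y $ 2"
  obtains t where "x = t *s y"
proof (rule parallel_vectors[OF assms(1), of x])
  fix i j :: 3
  show "x $ i * y $ j = x $ j * y $ i"
    using exhaust_3[of i] exhaust_3[of j] assms(2-) by auto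
qed (rule that)

text \<open>For independent \<open>x\<close> and \<open>y\<close> this is the coefficient vector of
  the line joining them. Coordinates are listed as 1, 2, 3, where 3 is the index 0.\<close>

definition cross :: "complex^3 \<Rightarrow> complex^3 \<Rightarrow> complex^3" where
  "cross x y = vector [x $ 2 * y $ 3 - x $ 3 * y $ 2, x $ 3 * y $ 1 - x $ 1 * y $ 3, x $ 1 * y $ 2 - x $ 2 * y $ 1]"

lemma cross_components:
  "cross x y $ 1 = x $ 2 * y $ 3 - x $ 3 * y $ 2" "cross x y $ 2 = x $ 3 * y $ 1 - x $ 1 * y $ 3"
  "cross x y $ 3 = x $ 1 * y $ 2 - x $ 2 * y $ 1"
  by (simp_all add: cross_def)

text \<open>The double product of \<open>w\<close> with \<open>cross x y\<close> is
  \<open>x (w.y) - y (w.x)\<close>, hence 0. The pairing here is bilinear, not Hermitian.\<close>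

lemma orthogonal_parallel_cross:
  assumes "cross x y \<noteq> 0" and "(\<Sum>i\<in>UNIV. w $ i * x $ i) = 0" and "(\<Sum>i\<in>UNIV. w $ i * y $ i) = 0"
  obtains t where "w = t *s cross x y"
proof (rule parallel_vectors_3[OF assms(1), of w])
  note dots = assms(2,3)[unfolded sum_3]
  show "w $ 1 * cross x y $ 2 = w $ 2 * cross x y $ 1"
    unfolding cross_components using dots by algebra
  show "w $ 1 * cross x y $ 3 = w $ 3 * cross x y $ 1"
    unfolding cross_components using dots by algebra
  show "w $ 2 * cross x y $ 3 = w $ 3 * cross x y $ 2"
    unfolding cross_components using dots by algebra
qed (rule that)

section \<open>The secant line of the isotropic conic through \<open>P\<close> and
  \<open>Q\<close>\<close>

locale isotropic_secant =
  fixes P Q a :: "complex^3"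
  assumes P: "P \<noteq> 0" and Q: "Q \<noteq> 0" and distinct: "\<forall>t. P \<noteq> t *s Q"
    and P_conic: "eval_at isotropic_conic P = 0" and Q_conic: "eval_at isotropic_conic Q = 0"
    and a: "a \<noteq> 0"
    and P_line: "eval_at (linear_form a) P = 0" and Q_line: "eval_at (linear_form a) Q = 0"
begin

abbreviation "l \<equiv> linear_form a"
abbreviation "q \<equiv> isotropic_conic"

lemma cross_nonzero: "cross P Q \<noteq> 0"
proof
  assume "cross P Q = 0"
  then have 0: "cross P Q $ i = 0" for i by simp
  obtain t where "P = t *s Q"
    using 0[of 1] 0[of 2] 0[of 3] unfolding cross_components
    by (elim parallel_vectors_3[OF Q, of P, rotated -1]) simp_all
  then show False using distinct by blast
qed

text \<open>Otherwise \<open>P\<close> and \<open>Q\<close> would each be orthogonal to both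
  \<open>P\<close> and \<open>Q\<close>, so both would be multiples of \<open>cross P Q\<close> and
  represent the same point.\<close>

lemma PQ_nonzero: "(\<Sum>i\<in>UNIV. P $ i * Q $ i) \<noteq> 0"
proof
  assume PQ: "(\<Sum>i\<in>UNIV. P $ i * Q $ i) = 0"
  have PP: "(\<Sum>i\<in>UNIV. P $ i * P $ i) = 0" and QQ: "(\<Sum>i\<in>UNIV. Q $ i * Q $ i) = 0"
    using P_conic Q_conic by (simp_all add: eval_at_isotropic_conic power2_eq_square)
  obtain t where t: "P = t *s cross P Q"
    using orthogonal_parallel_cross[OF cross_nonzero PP PQ] .
  have QP: "(\<Sum>i\<in>UNIV. Q $ i * P $ i) = 0"
    using PQ by (simp add: mult.commute)
  obtain t' where t': "Q = t' *s cross P Q"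
    using orthogonal_parallel_cross[OF cross_nonzero QP QQ] .
  have "t' \<noteq> 0" using t' Q by auto
  then have "P = (t / t') *s Q"
    using t t' by (metis nonzero_eq_divide_eq vector_smult_assoc)
  then show False using distinct by blast
qed

lemma orthogonal_parallel:
  assumes "(\<Sum>i\<in>UNIV. w $ i * P $ i) = 0" and "(\<Sum>i\<in>UNIV. w $ i * Q $ i) = 0"
  obtains t where "w = t *s a"
proof -
  obtain t where t: "w = t *s cross P Q"
    using orthogonal_parallel_cross[OF cross_nonzero assms] .
  obtain t' where t': "a = t' *s cross P Q"
    using orthogonal_parallel_cross[OF cross_nonzero] P_line Q_line unfolding eval_at_linear_form by blast
  have "t' \<noteq> 0" using t' a by auto
  then have "w = (t / t') *s a"
    using t t' by (metis nonzero_eq_divide_eq vector_smult_assoc)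
  then show ?thesis by (rule that)
qed

text \<open>The value is \<open>a.a\<close>, and \<open>a\<close> is a nonzero multiple of
  \<open>cross P Q\<close>. By Lagrange's identity \<open>cross P Q\<close> has square
  \<open>(P.P)(Q.Q) - (P.Q)^2 = -(P.Q)^2\<close>.\<close>

lemma line_not_through_pole: "eval_at l a \<noteq> 0"
proof -
  obtain t where t: "a = t *s cross P Q"
    using orthogonal_parallel_cross[OF cross_nonzero] P_line Q_line unfolding eval_at_linear_form by blast
  then have "t \<noteq> 0" using a by auto
  have PP: "P $ 1 * P $ 1 + P $ 2 * P $ 2 + P $ 3 * P $ 3 = 0"
    and QQ: "Q $ 1 * Q $ 1 + Q $ 2 * Q $ 2 + Q $ 3 * Q $ 3 = 0"
    using P_conic Q_conic by (simp_all add: eval_at_isotropic_conic power2_eq_square sum_3)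
  have "(\<Sum>i\<in>UNIV. cross P Q $ i * cross P Q $ i) = - (\<Sum>i\<in>UNIV. P $ i * Q $ i)\<^sup>2"
    unfolding sum_3 cross_components using PP QQ by algebra
  moreover have "eval_at l a = t\<^sup>2 * (\<Sum>i\<in>UNIV. cross P Q $ i * cross P Q $ i)"
    unfolding eval_at_linear_form by (subst (1 2) t) (simp add: sum_distrib_left power2_eq_square mult_ac)
  ultimately show ?thesis using PQ_nonzero \<open>t \<noteq> 0\<close> by simp
qed

text \<open>At such a point every \<open>l^2 + r q\<close> takes the nonzero value
  \<open>l^2\<close>, which shows that \<open>q\<close> divides no product of such conics.\<close>

lemma conic_point_off_line:
  obtains R where "eval_at q R = 0" and "eval_at l R \<noteq> 0"
proof -
  define PQ where "PQ = (\<Sum>i\<in>UNIV. P $ i * Q $ i)"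
  \<comment> \<open>For \<open>R = P + t Q + a\<close> the orthogonality relations leave
    \<open>q(R) = 2 t (P.Q) + a.a\<close>; this \<open>t\<close> makes it vanish, while
    \<open>l(R) = a.a\<close>.\<close>
  define t where "t = - eval_at l a / (2 * PQ)"
  have "PQ \<noteq> 0" unfolding PQ_def by (rule PQ_nonzero)
  then have t: "2 * t * PQ + eval_at l a = 0" by (simp add: t_def)
  have zeros: "P $ 1 * P $ 1 + P $ 2 * P $ 2 + P $ 3 * P $ 3 = 0"
    "Q $ 1 * Q $ 1 + Q $ 2 * Q $ 2 + Q $ 3 * Q $ 3 = 0"
    "a $ 1 * P $ 1 + a $ 2 * P $ 2 + a $ 3 * P $ 3 = 0"
    "a $ 1 * Q $ 1 + a $ 2 * Q $ 2 + a $ 3 * Q $ 3 = 0"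
    using P_conic Q_conic P_line Q_line
    by (simp_all add: eval_at_isotropic_conic eval_at_linear_form power2_eq_square sum_3)
  have "eval_at q (P + t *s Q + a) = 0"
    using t zeros unfolding PQ_def eval_at_isotropic_conic eval_at_linear_form sum_3
      vector_add_component vector_smult_component by algebra
  moreover have "eval_at l (P + t *s Q + a) = eval_at l a"
    using zeros unfolding eval_at_linear_form sum_3 vector_add_component vector_smult_component
    by algebra
  ultimately show ?thesis using that line_not_through_pole by metis
qed

text \<open>Tangency makes \<open>P\<close> and \<open>Q\<close> eigenvectors of the Hessian matrix
  of \<open>c\<close>. With a common eigenvalue \<open>2 t\<close>, the matrix minus
  \<open>2 t\<close> times the identity kills both, so it is a multiple of the matrix of
  \<open>l^2\<close>.\<close>

lemma bitangent_conic_form: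
  assumes "bitangent_conic c P Q"
  obtains \<alpha> \<beta> where "\<beta> \<noteq> 0" and "c = Const \<beta> * (l\<^sup>2 + Const \<alpha> * q)"
proof -
  from assms have hom: "homogeneous c 2" and ndvd: "\<not> q dvd c"
    by (auto simp: bitangent_conic_def tangent_to_q_def)
  obtain C :: "3 \<Rightarrow> 3 \<Rightarrow> complex" where sym: "\<And>i j. C i j = C j i"
    and grad: "\<And>j. pdiff j c = (\<Sum>i\<in>UNIV. X i * Const (C i j))"
    and euler: "2 * c = (\<Sum>j\<in>UNIV. X j * (\<Sum>i\<in>UNIV. X i * Const (C i j)))"
    using quadratic_form[OF hom] by blast
  obtain t where t: "\<And>j. (\<Sum>i\<in>UNIV. P $ i * C i j) = t * (2 * P $ j)"
    using assms unfolding bitangent_conic_def tangent_to_q_def grad pdiff_isotropic_conic by auto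
  obtain t' where t': "\<And>j. (\<Sum>i\<in>UNIV. Q $ i * C i j) = t' * (2 * Q $ j)"
    using assms unfolding bitangent_conic_def tangent_to_q_def grad pdiff_isotropic_conic by auto
  \<comment> \<open>Pairing \<open>P\<close> with \<open>Q\<close> through the symmetric matrix
    \<open>C\<close> in two ways shows that the eigenvalues agree, because \<open>P.Q\<close> is
    nonzero.\<close>
  have "2 * t * (\<Sum>j\<in>UNIV. P $ j * Q $ j) = (\<Sum>j\<in>UNIV. (\<Sum>i\<in>UNIV. P $ i * C i j) * Q $ j)"
    unfolding t sum_distrib_left by (simp add: mult_ac)
  also have "\<dots> = (\<Sum>j\<in>UNIV. \<Sum>i\<in>UNIV. P $ i * C i j * Q $ j)"
    by (simp add: sum_distrib_right)
  also have "\<dots> = (\<Sum>i\<in>UNIV. \<Sum>j\<in>UNIV. P $ i * C i j * Q $ j)"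
    by (rule sum.swap)
  also have "\<dots> = (\<Sum>i\<in>UNIV. P $ i * (\<Sum>j\<in>UNIV. Q $ j * C j i))"
    by (simp add: sum_distrib_left mult_ac sym)
  also have "\<dots> = 2 * t' * (\<Sum>j\<in>UNIV. P $ j * Q $ j)"
    unfolding t' sum_distrib_left by (simp add: mult_ac)
  finally have tt': "t' = t" using PQ_nonzero by simp
  \<comment> \<open>The Hessian matrix of \<open>c - t q\<close>; its columns are orthogonal to
    \<open>P\<close> and \<open>Q\<close>, hence multiples of \<open>a\<close>.\<close>
  define M where "M i j = C i j - (if i = j then 2 * t else 0)" for i j
  have "\<exists>m. \<forall>i. M i j = m * a $ i" for j
  proof -
    have if_mult: "x * (if i = j then y else 0) = (if i = j then x * y else 0)" for x y :: complex and i
      by simp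
    have "(\<Sum>i\<in>UNIV. (\<chi> i. M i j) $ i * P $ i) = (\<Sum>i\<in>UNIV. P $ i * C i j) - t * (2 * P $ j)"
      by (simp add: M_def left_diff_distrib right_diff_distrib sum_subtractf mult.commute[of _ "P $ _"] if_mult)
    moreover have "(\<Sum>i\<in>UNIV. (\<chi> i. M i j) $ i * Q $ i) = (\<Sum>i\<in>UNIV. Q $ i * C i j) - t * (2 * Q $ j)"
      by (simp add: M_def left_diff_distrib right_diff_distrib sum_subtractf mult.commute[of _ "Q $ _"] if_mult)
    ultimately obtain m where "(\<chi> i. M i j) = m *s a"
      using orthogonal_parallel[of "\<chi> i. M i j"] t t' tt' by auto
    then show ?thesis by (auto simp: vec_eq_iff)
  qed
  then obtain m where m: "\<And>i j. M i j = m j * a $ i" by metis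
  \<comment> \<open>By symmetry the column factors \<open>m j\<close> are proportional to
    \<open>a $ j\<close>, so \<open>M\<close> has rank at most one.\<close>
  have "M i j = M j i" for i j by (simp add: M_def sym)
  then have "m j * a $ i = m i * a $ j" for i j by (simp only: m)
  then obtain b where "(\<chi> j. m j) = b *s a"
    using parallel_vectors[OF a, of "\<chi> j. m j"] by auto
  then have b: "m j = b * a $ j" for j by (simp add: vec_eq_iff)
  have C: "C i j = (if i = j then 2 * t else 0) + b * a $ j * a $ i" for i j
    using m[of i j] b[of j] by (cases "i = j") (simp_all add: M_def algebra_simps)
  have row: "(\<Sum>i\<in>UNIV. X i * Const (C i j)) = Const (2 * t) * X j + Const (b * a $ j) * l" for j
  proof -
    have "X i * Const (C i j) = (if i = j then Const (2 * t) * X j else 0) + Const (b * a $ j) * (Const (a $ i) * X i)" for i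
      by (simp add: C Const_add Const_mult algebra_simps)
    then show ?thesis by (simp add: sum.distrib linear_form_def sum_distrib_left)
  qed
  have "2 * c = Const (2 * t) * q + Const b * l\<^sup>2"
    unfolding euler row
    by (simp add: distrib_left sum.distrib isotropic_conic_def linear_form_def[of a] power2_eq_square
        sum_distrib_left sum_distrib_right Const_mult mult_ac)
  then have "Const (1 / 2) * (Const 2 * c) = Const (1 / 2) * (Const (2 * t) * q + Const b * l\<^sup>2)"
    by (simp add: Const_numeral)
  then have c: "c = Const t * q + Const (b / 2) * l\<^sup>2"
    unfolding distrib_left mult.assoc[symmetric] Const_mult[symmetric] by simp
  \<comment> \<open>For \<open>b = 0\<close> the conic would be a multiple of \<open>q\<close>,
    which tangency excludes.\<close>
  have "b \<noteq> 0" using c ndvd by auto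
  moreover from this have "c = Const (b / 2) * (l\<^sup>2 + Const (2 * t / b) * q)"
    unfolding distrib_left mult.assoc[symmetric] Const_mult[symmetric] c by (simp add: add_ac)
  ultimately show ?thesis using that[of "b / 2" "2 * t / b"] by simp
qed

section \<open>Products of conics in the pencil of \<open>l^2\<close> and \<open>q\<close>\<close>

lemma isotropic_conic_not_dvd:
  assumes "eval_at g R \<noteq> 0" and "eval_at q R = 0"
  shows "\<not> q dvd g"
  using assms by (auto simp: dvd_def)

text \<open>The gradient of \<open>l^2\<close> has the factor \<open>l\<close>, so it vanishes on
  the line and only \<open>r * q\<close> contributes.\<close>

lemma pencil_conic_at:
  assumes "eval_at q p = 0" and "eval_at l p = 0"
  shows "eval_at (l\<^sup>2 + Const r * q) p = 0"
    and "eval_at (pdiff i (l\<^sup>2 + Const r * q)) p = r * eval_at (pdiff i q) p"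
  using assms by (simp_all add: pdiff_add pdiff_Const_mult power2_eq_square pdiff_mult)

lemma homogeneous_line: "homogeneous l 1"
  unfolding linear_form_def
  by (intro homogeneous_sum) (use homogeneous_mult[OF homogeneous_Const homogeneous_X] in simp)

lemma homogeneous_pencil_conic: "homogeneous (l\<^sup>2 + Const r * q) 2"
proof -
  have "homogeneous q 2"
    unfolding isotropic_conic_def
    by (intro homogeneous_sum) (use homogeneous_power[OF homogeneous_X, of _ 2] in simp)
  then have "homogeneous (Const r * q) 2"
    using homogeneous_mult[OF homogeneous_Const] by fastforce
  moreover have "homogeneous (l\<^sup>2) 2"
    using homogeneous_power[OF homogeneous_line, of 2] by simp
  ultimately show ?thesis by (rule homogeneous_add[rotated])
qed

text \<open>One factor already vanishes at \<open>p\<close>, so by the Leibniz rule the gradient of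
  the product is that of this factor scaled by the value of the cofactor.\<close>

lemma tangent_to_q_pencil_prod:
  assumes "finite A" and "A \<noteq> {}" and "eval_at q p = 0" and "eval_at l p = 0"
  shows "tangent_to_q (\<Prod>k\<in>A. l\<^sup>2 + Const (r k) * q) p"
proof -
  obtain x where x: "x \<in> A" using assms(2) by blast
  define h where "h = (\<Prod>k\<in>A - {x}. l\<^sup>2 + Const (r k) * q)"
  have g: "(\<Prod>k\<in>A. l\<^sup>2 + Const (r k) * q) = (l\<^sup>2 + Const (r x) * q) * h"
    unfolding h_def using prod.remove[OF assms(1) x] .
  obtain R where R: "eval_at q R = 0" "eval_at l R \<noteq> 0"
    by (rule conic_point_off_line)
  have "eval_at (\<Prod>k\<in>A. l\<^sup>2 + Const (r k) * q) R \<noteq> 0"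
    using R assms(1) by simp
  then have "\<not> q dvd (\<Prod>k\<in>A. l\<^sup>2 + Const (r k) * q)"
    using R(1) by (rule isotropic_conic_not_dvd)
  moreover have "eval_at (pdiff i ((l\<^sup>2 + Const (r x) * q) * h)) p =
      (r x * eval_at h p) * eval_at (pdiff i q) p" for i
    using assms(3,4) by (simp add: pdiff_mult pencil_conic_at(2))
  moreover have "eval_at ((l\<^sup>2 + Const (r x) * q) * h) p = 0"
    using assms(3,4) by simp
  ultimately show ?thesis
    using assms(3) unfolding tangent_to_q_def g by blast
qed

lemma bitangent_pencil_conic: "bitangent_conic (l\<^sup>2 + Const r * q) P Q"
  using tangent_to_q_pencil_prod[of "{()}" _ "\<lambda>_. r"] P_conic Q_conic P_line Q_line
  by (simp add: bitangent_conic_def homogeneous_pencil_conic)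

text \<open>For \<open>n = 0\<close> the product is 1, the empty curve, which is tangent to nothing;
  hence the bound in the third claim.\<close>

lemma pencil_prod_properties:
  fixes r :: "nat \<Rightarrow> complex" and n :: nat
  defines "g \<equiv> (\<Prod>k=1..n. l\<^sup>2 + Const (r k) * q)"
  shows "g \<noteq> 0" and "homogeneous g (2 * n)"
    and "n \<ge> 1 \<Longrightarrow> tangent_to_q g P \<and> tangent_to_q g Q"
    and "\<exists>d. (\<forall>i\<in>{1..n}. bitangent_conic (d i) P Q) \<and> g = (\<Prod>i=1..n. d i)"
proof -
  obtain R where R: "eval_at q R = 0" "eval_at l R \<noteq> 0"
    by (rule conic_point_off_line)
  have "eval_at g R \<noteq> 0" using R by (simp add: g_def)
  then show "g \<noteq> 0" by auto
  show "homogeneous g (2 * n)"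
    using homogeneous_prod[of "{1..n}" "\<lambda>k. l\<^sup>2 + Const (r k) * q" 2] homogeneous_pencil_conic
    by (simp add: g_def)
  show "tangent_to_q g P \<and> tangent_to_q g Q" if "n \<ge> 1"
    using that P_conic Q_conic P_line Q_line unfolding g_def
    by (auto intro!: tangent_to_q_pencil_prod)
  show "\<exists>d. (\<forall>i\<in>{1..n}. bitangent_conic (d i) P Q) \<and> g = (\<Prod>i=1..n. d i)"
    unfolding g_def using bitangent_pencil_conic by (intro exI[of _ "\<lambda>k. l\<^sup>2 + Const (r k) * q"]) simp
qed

text \<open>Up to a constant the product of the conics is the homogenization at \<open>q\<close> and
  \<open>l^2\<close> of one univariate polynomial \<open>p\<close>, so both eigenschemes can be read
  off from \<open>p\<close> and its derivative.\<close>

lemma eigenscheme_pencil: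
  fixes c :: "nat \<Rightarrow> cpoly3" and s :: nat
  assumes "s \<ge> 1" and "\<forall>i\<in>{1..s}. bitangent_conic (c i) P Q"
  obtains r r' where
    "eigenscheme (\<Prod>i=1..s. c i) =
      scheme_sum (plane_curve (l * (\<Prod>k=1..s - 1. l\<^sup>2 + Const (r k) * q))) (eigenscheme l)"
    and "eigenscheme (l * (\<Prod>i=1..s. c i)) =
      scheme_sum (plane_curve (\<Prod>k=1..s. l\<^sup>2 + Const (r' k) * q)) (eigenscheme l)"
proof -
  have "\<forall>i\<in>{1..s}. \<exists>\<alpha> \<beta>. \<beta> \<noteq> 0 \<and> c i = Const \<beta> * (l\<^sup>2 + Const \<alpha> * q)"
    using assms(2) bitangent_conic_form by metis
  then obtain \<alpha> \<beta> where \<beta>: "\<And>i. i \<in> {1..s} \<Longrightarrow> \<beta> i \<noteq> 0"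
    and c: "\<And>i. i \<in> {1..s} \<Longrightarrow> c i = Const (\<beta> i) * (l\<^sup>2 + Const (\<alpha> i) * q)"
    by metis
  define B where "B = (\<Prod>i=1..s. \<beta> i)"
  define p where "p = (\<Prod>i=1..s. [:\<alpha> i, 1:])"
  let ?h = "homogenize q (l\<^sup>2)"
  have B: "B \<noteq> 0" using \<beta> by (simp add: B_def)
  have "(\<Prod>i=1..s. c i) = (\<Prod>i=1..s. Const (\<beta> i) * (l\<^sup>2 + Const (\<alpha> i) * q))"
    using c by (rule prod.cong[OF refl])
  then have prod_c: "(\<Prod>i=1..s. c i) = Const B * ?h s p"
    using homogenize_prod_linear[of "{1..s}" q "l\<^sup>2" \<alpha>]
    by (simp add: p_def B_def Const_prod prod.distrib)
  have degree_p: "degree p = s" by (simp add: p_def degree_prod_linear)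
  have "lead_coeff p = 1" by (simp add: p_def lead_coeff_prod)
  then have coeff_p: "coeff p s = 1" by (simp add: degree_p)
  \<comment> \<open>Its top coefficient \<open>s\<close> is nonzero, so the degree is exactly
    \<open>s - 1\<close> and the factorization consists of \<open>s - 1\<close> conics.\<close>
  define p' where "p' = pderiv p"
  have degree_p': "degree p' = s - 1" by (simp add: p'_def degree_pderiv degree_p)
  have coeff_p': "coeff p' (s - 1) = of_nat s"
    using assms(1) coeff_p by (simp add: p'_def coeff_pderiv)
  have rot: "rotation i j (?h s p) = ?h (s - 1) p' * (2 * l * minor a i j)" for i j
    using rotation_homogenize[OF rotation_isotropic_conic, of i j "l\<^sup>2" "s - 1" p] assms(1)
    by (simp add: p'_def rotation_power rotation_linear_form mult.assoc)
  obtain r where r: "?h (s - 1) p' = Const (of_nat s) * (\<Prod>k=1..s - 1. l\<^sup>2 + Const (r k) * q)"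
    using homogenize_factorization[of q "l\<^sup>2" p'] unfolding degree_p' coeff_p' by blast
  have 1: "X i * pdiff j (\<Prod>i=1..s. c i) - X j * pdiff i (\<Prod>i=1..s. c i) =
      Const (B * of_nat s * 2) * (l * (\<Prod>k=1..s - 1. l\<^sup>2 + Const (r k) * q) * minor a i j)" for i j
    unfolding rotation_def[symmetric] prod_c rotation_mult rot r
    by (simp add: Const_mult Const_numeral mult_ac)
  \<comment> \<open>This is the polynomial of the form \<open>G + 2 v G_v\<close>, where
    \<open>pCons 0\<close> is multiplication by \<open>v\<close>. Its top coefficient
    \<open>2 s + 1\<close> is nonzero, so the degree stays \<open>s\<close>.\<close>
  define p'' where "p'' = p + smult 2 (pCons 0 p')"
  have coeff_p'': "coeff p'' s = of_nat (2 * s + 1)"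
    using assms(1) coeff_p coeff_p' by (cases s) (simp_all add: p''_def)
  have "degree p'' \<le> s"
    using degree_pCons_le[of 0 p'] assms(1) unfolding p''_def
    by (intro degree_add_le degree_smult_le[THEN order_trans]) (simp_all add: degree_p degree_p')
  moreover have "s \<le> degree p''"
    by (rule le_degree) (unfold coeff_p'' of_nat_eq_0_iff, simp)
  ultimately have degree_p'': "degree p'' = s" by simp
  obtain r' where r': "?h s p'' = Const (of_nat (2 * s + 1)) * (\<Prod>k=1..s. l\<^sup>2 + Const (r' k) * q)"
    using homogenize_factorization[of q "l\<^sup>2" p''] unfolding degree_p'' coeff_p'' by blast
  have h'': "?h s p'' = ?h s p + 2 * l\<^sup>2 * ?h (s - 1) p'"
    using homogenize_pCons_0[of q "l\<^sup>2" "s - 1" p'] assms(1)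
    by (simp add: p''_def homogenize_add homogenize_smult Const_numeral mult.assoc del: smult_pCons)
  have "X i * pdiff j (l * (\<Prod>i=1..s. c i)) - X j * pdiff i (l * (\<Prod>i=1..s. c i)) =
      Const B * (?h s p'' * minor a i j)" for i j
    unfolding rotation_def[symmetric] prod_c rotation_mult rot h'' rotation_linear_form
    by (simp add: algebra_simps power2_eq_square)
  then have 2: "X i * pdiff j (l * (\<Prod>i=1..s. c i)) - X j * pdiff i (l * (\<Prod>i=1..s. c i)) =
      Const (B * of_nat (2 * s + 1)) * ((\<Prod>k=1..s. l\<^sup>2 + Const (r' k) * q) * minor a i j)" for i j
    unfolding r' by (simp only: Const_mult mult.assoc)
  have "B * of_nat s * 2 \<noteq> 0" using B assms(1) by simp
  moreover have "B * of_nat (2 * s + 1) \<noteq> 0"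
    using B by (simp only: mult_eq_0_iff of_nat_eq_0_iff) simp
  ultimately show ?thesis
    using that eigenscheme_eq_scheme_sum[OF _ 1] eigenscheme_eq_scheme_sum[OF _ 2] by metis
qed

end

theorem proposition2p12:
  fixes P Q a :: "complex^3" and l :: cpoly3 and c :: "nat \<Rightarrow> cpoly3" and s :: nat
  assumes "P \<noteq> 0" and "Q \<noteq> 0" and "\<forall>t. P \<noteq> t *s Q"
    and "eval_at isotropic_conic P = 0" and "eval_at isotropic_conic Q = 0"
    and "a \<noteq> 0" and "l = linear_form a" and "eval_at l P = 0" and "eval_at l Q = 0"
    and "s \<ge> 1"
    and "\<forall>i\<in>{1..s}. bitangent_conic (c i) P Q"
  shows "(\<exists>g. g \<noteq> 0 \<and> homogeneous g (2 * (s - 1)) \<and>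
            eigenscheme (\<Prod>i=1..s. c i) =
              scheme_sum (scheme_sum (plane_curve l) (plane_curve g)) (eigenscheme l) \<and>
            (eval_at g a \<noteq> 0 \<longrightarrow>
              eigenscheme (\<Prod>i=1..s. c i) =
                scheme_union (scheme_sum (plane_curve l) (plane_curve g)) (eigenscheme l)) \<and>
            (eval_at g a \<noteq> 0 \<and> \<not> l dvd g \<longrightarrow>
              eigenscheme (\<Prod>i=1..s. c i) =
                scheme_union (scheme_union (plane_curve l) (plane_curve g)) (eigenscheme l)) \<and>
            (s \<ge> 2 \<longrightarrow> tangent_to_q g P \<and> tangent_to_q g Q) \<and>
            (\<exists>d. (\<forall>i\<in>{1..s - 1}. bitangent_conic (d i) P Q) \<and> g = (\<Prod>i=1..s - 1. d i)))
       \<and> (\<exists>g. g \<noteq> 0 \<and> homogeneous g (2 * s) \<and>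
            eigenscheme (l * (\<Prod>i=1..s. c i)) =
              scheme_sum (plane_curve g) (eigenscheme l) \<and>
            (eval_at g a \<noteq> 0 \<longrightarrow>
              eigenscheme (l * (\<Prod>i=1..s. c i)) =
                scheme_union (plane_curve g) (eigenscheme l)) \<and>
            tangent_to_q g P \<and> tangent_to_q g Q \<and>
            (\<exists>d. (\<forall>i\<in>{1..s}. bitangent_conic (d i) P Q) \<and> g = (\<Prod>i=1..s. d i)))"
proof -
  interpret isotropic_secant P Q a
    using assms by unfold_locales auto
  have l: "l = linear_form a" by fact
  obtain r r' where
    r: "eigenscheme (\<Prod>i=1..s. c i) =
      scheme_sum (plane_curve (l * (\<Prod>k=1..s - 1. l\<^sup>2 + Const (r k) * isotropic_conic))) (eigenscheme l)"
    and r': "eigenscheme (l * (\<Prod>i=1..s. c i)) =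
      scheme_sum (plane_curve (\<Prod>k=1..s. l\<^sup>2 + Const (r' k) * isotropic_conic)) (eigenscheme l)"
    using eigenscheme_pencil[OF assms(10,11)] unfolding l by blast
  define g where "g = (\<Prod>k=1..s - 1. l\<^sup>2 + Const (r k) * isotropic_conic)"
  define g' where "g' = (\<Prod>k=1..s. l\<^sup>2 + Const (r' k) * isotropic_conic)"
  note g_props = pencil_prod_properties[where n = "s - 1" and r = r, folded l, folded g_def]
  note g'_props = pencil_prod_properties[where n = s and r = r', folded l, folded g'_def]
  have lg: "eigenscheme (\<Prod>i=1..s. c i) =
      scheme_sum (scheme_sum (plane_curve l) (plane_curve g)) (eigenscheme l)"
    unfolding r g_def scheme_sum_plane_curve ..
  \<comment> \<open>Neither \<open>l\<close> nor \<open>g\<close> vanishes at \<open>a\<close>, so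
    the curve \<open>l * g\<close> misses the point and sum and union agree.\<close>
  have union: "scheme_union (scheme_sum (plane_curve l) (plane_curve g)) (eigenscheme l) =
      scheme_sum (scheme_sum (plane_curve l) (plane_curve g)) (eigenscheme l)" if "eval_at g a \<noteq> 0"
    unfolding scheme_sum_plane_curve l
    using homogeneous_mult[OF homogeneous_line g_props(2)] that line_not_through_pole
    by (intro scheme_union_point) (auto simp: l)
  have union_line: "scheme_union (plane_curve l) (plane_curve g) =
      scheme_sum (plane_curve l) (plane_curve g)" if "\<not> l dvd g"
    using scheme_union_line[OF \<open>a \<noteq> 0\<close>] that unfolding l by blast
  have union': "scheme_union (plane_curve g') (eigenscheme l) =
      scheme_sum (plane_curve g') (eigenscheme l)" if "eval_at g' a \<noteq> 0"
    using scheme_union_point[OF g'_props(2) that] unfolding l .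
  have tangent: "s \<ge> 2 \<longrightarrow> tangent_to_q g P \<and> tangent_to_q g Q"
    using g_props(3) by auto
  have tangent': "tangent_to_q g' P" "tangent_to_q g' Q"
    using g'_props(3) \<open>s \<ge> 1\<close> by auto
  show ?thesis
    using g_props(1,2,4) g'_props(1,2,4) lg r'[folded g'_def] union union_line union' tangent tangent'
    by (intro conjI[OF exI[of _ g] exI[of _ g']]) simp_all
qed

end
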